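(* Let $A\in\mathbf{R}^{m\times n}$ have unit $\ell_2$-norm columns, let $x^*\in\mathbf{R}^n$ with $\|x^*\|_0=k^*$, let $\epsilon\in\mathbf{R}^m$, and $b=Ax^*+\epsilon$. Let $\{x^{(t)}\}_{t\ge0}$ be a sequence generated by the AIT algorithm with sparsity level $k$, step size $s$, an initial point $x^{(0)}\in\mathbf{R}^n$, and a defining function with boundedness parameters $0\le c_2\le c_1\le1$. Put $$L=\min\Bigl\{\sqrt{4+2c_1^2k^*},\ \sqrt{2+(3-c_2^2)k^*}\Bigr\}.$$ Assume that the restricted isometry constant of $A$ satisfies $\delta_{3k^*+1}<\frac1L$, and that (i) $k=k^*$; (ii) $\underline{s}<s<\overline{s}$, where $\underline{s}=\dfrac{1-\frac1L}{1-\delta_{3k^*+1}}$ and $\overline{s}=\dfrac{1+\frac1L}{1+\delta_{3k^*+1}}$. Then, with $\gamma_s=|1-s|+s\,\delta_{3k^*+1}$ and $\rho_s=\gamma_sL$, one has $\rho_s<1$ and for all $t$ $$\|x^{(t)}-x^*\|_2\le(\rho_s)^t\|x^*-x^{(0)}\|_2+\frac{sL}{1-\rho_s}\|A^T\epsilon\|_2.$$ In particular, when $\epsilon=0$, $\|x^{(t)}-x^*\|_2\le(\rho_s)^t\|x^*-x^{(0)}\|_2$.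
   Context: $\|x\|_0$ is the number of nonzero components of $x$. For a positive integer $r$, the restricted isometry constant $\delta_r$ of $A$ is the smallest $\delta$ such that $(1-\delta)\|z\|_2^2\le\|Az\|_2^2\le(1+\delta)\|z\|_2^2$ for all $z\in\mathbf{R}^n$ with $\|z\|_0\le r$. Defining function: a family of real functions $f_\tau(u)$ (threshold $\tau\ge0$, defined for $|u|\ge\tau$) such that (1) $f_\tau$ is odd; (2) $f_\tau(u)<f_\tau(v)$ whenever $\tau\le u<v$; (3) there are constants $0\le c_2\le c_1\le1$ (the boundedness parameters) with $u-c_1\tau\le f_\tau(u)\le u-c_2\tau$ for all $u\ge\tau$. AIT (adaptively iterative thresholding) algorithm: given $A\in\mathbf{R}^{m\times n}$ with unit $\ell_2$-norm columns, $b\in\mathbf{R}^m$, a sparsity level $k$ (with $1\le k<n$), a step size $s>0$ and an initial point $x^{(0)}\in\mathbf{R}^n$, for $t=0,1,2,\dots$: set $z^{(t+1)}=x^{(t)}-sA^T(Ax^{(t)}-b)$; let $I^{t+1}$ be the index set of the $k$ largest components of $z^{(t+1)}$ in magnitude and let $\tau^{(t+1)}=|z^{(t+1)}_{[k+1]}|$, where $[k+1]$ is the index of the $(k+1)$-th largest component of $z^{(t+1)}$ in magnitude (ties broken arbitrarily, $[k+1]\notin I^{t+1}$); set $x^{(t+1)}_i=f_{\tau^{(t+1)}}(z^{(t+1)}_i)$ for $i\in I^{t+1}$ and $x^{(t+1)}_i=0$ otherwise.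
   Formalization: The initial point x^(0) is assumed to have at most k nonzero components; for an arbitrary x^(0) in R^n the stated bound can fail at t=1. *)

theory Defs
  imports "HOL-Analysis.Analysis"
begin

definition l0norm :: "real ^ 'n \<Rightarrow> nat" where
  "l0norm x = card {i. x $ i \<noteq> 0}"

definition restricted_isometry_const :: "real ^ 'n ^ 'm \<Rightarrow> nat \<Rightarrow> real" where
  "restricted_isometry_const A r =
     (LEAST \<delta>. \<forall>z. l0norm z \<le> r \<longrightarrow>
        (1 - \<delta>) * (norm z)\<^sup>2 \<le> (norm (A *v z))\<^sup>2 \<and>
        (norm (A *v z))\<^sup>2 \<le> (1 + \<delta>) * (norm z)\<^sup>2)"

(* The value "f tau u" stands for f_tau(u), which is meaningful only for tau >= 0 and
   |u| >= tau; outside this domain f is unconstrained. The parameters c1, c2 do not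
   depend on tau. *)
definition defining_function ::
  "(real \<Rightarrow> real \<Rightarrow> real) \<Rightarrow> real \<Rightarrow> real \<Rightarrow> bool" where
  "defining_function f c1 c2 \<longleftrightarrow>
     0 \<le> c2 \<and> c2 \<le> c1 \<and> c1 \<le> 1 \<and>
     (\<forall>\<tau>\<ge>0. \<forall>u. \<tau> \<le> \<bar>u\<bar> \<longrightarrow> f \<tau> (- u) = - f \<tau> u) \<and>
     (\<forall>\<tau>\<ge>0. \<forall>u v. \<tau> \<le> u \<and> u < v \<longrightarrow> f \<tau> u < f \<tau> v) \<and>
     (\<forall>\<tau>\<ge>0. \<forall>u\<ge>\<tau>. u - c1 * \<tau> \<le> f \<tau> u \<and> f \<tau> u \<le> u - c2 * \<tau>)"

definition largest_index_set :: "nat \<Rightarrow> real ^ 'n \<Rightarrow> 'n set \<Rightarrow> bool" where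
  "largest_index_set k z I \<longleftrightarrow>
     card I = k \<and> (\<forall>i\<in>I. \<forall>j. j \<notin> I \<longrightarrow> \<bar>z $ j\<bar> \<le> \<bar>z $ i\<bar>)"

(* p is the index written [k+1], relative to the chosen set I of the k largest components. *)
definition next_largest_index :: "real ^ 'n \<Rightarrow> 'n set \<Rightarrow> 'n \<Rightarrow> bool" where
  "next_largest_index z I p \<longleftrightarrow> p \<notin> I \<and> (\<forall>j. j \<notin> I \<longrightarrow> \<bar>z $ j\<bar> \<le> \<bar>z $ p\<bar>)"

(* A relation rather than a function of x: ties may be broken arbitrarily, and
   differently in every iteration. *)
definition ait_step ::
  "real ^ 'n ^ 'm \<Rightarrow> real ^ 'm \<Rightarrow> nat \<Rightarrow> real \<Rightarrow> (real \<Rightarrow> real \<Rightarrow> real)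
    \<Rightarrow> real ^ 'n \<Rightarrow> real ^ 'n \<Rightarrow> bool" where
  "ait_step A b k s f x x' \<longleftrightarrow>
     (let z = x - s *\<^sub>R (transpose A *v (A *v x - b)) in
      \<exists>I p. largest_index_set k z I \<and> next_largest_index z I p \<and>
            x' = (\<chi> i. if i \<in> I then f \<bar>z $ p\<bar> (z $ i) else 0))"

definition ait_sequence ::
  "real ^ 'n ^ 'm \<Rightarrow> real ^ 'm \<Rightarrow> nat \<Rightarrow> real \<Rightarrow> (real \<Rightarrow> real \<Rightarrow> real)
    \<Rightarrow> (nat \<Rightarrow> real ^ 'n) \<Rightarrow> bool" where
  "ait_sequence A b k s f x \<longleftrightarrow> (\<forall>t. ait_step A b k s f (x t) (x (Suc t)))"

end

theory Submission
  imports Defs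
begin

text \<open>
  Write \<open>h\<close> for the current error, \<open>S\<close> for the support of the target vector, and \<open>e\<close> for the
  difference between the gradient iterate \<open>z\<close> and the target. Since \<open>e\<close> is \<open>h - s A\<^sup>T A h\<close> plus
  \<open>s A\<^sup>T \<epsilon>\<close>, one iteration splits into two independent estimates.

  The gradient step contracts when seen on few coordinates. The error \<open>h\<close> lives on at most \<open>2k\<close>
  coordinates, and one looks at \<open>e\<close> only on \<open>W = I \<union> S \<union> {p}\<close>; together these are at most \<open>3k + 1\<close>
  coordinates. On vectors supported there, the quadratic form of \<open>1 - s A\<^sup>T A\<close> is bounded by
  \<open>\<gamma> = \<bar>1 - s\<bar> + s \<delta>\<close>, hence by polarisation so is its bilinear form
  (\<open>restricted_isometry_bilinear\<close>), hence so is the norm of its restriction to \<open>W\<close>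
  (\<open>gradient_step_contraction\<close>).

  Thresholding amplifies the error on \<open>W\<close> by at most \<open>L\<close> (\<open>thresholding_error\<close>). The only
  damage beyond \<open>e\<close> itself comes from the threshold \<open>\<tau>\<close>: each of the \<open>d\<close> missed indices of \<open>S\<close>
  costs an additional \<open>\<tau>\<close>, each correctly kept index an additional \<open>c1 \<tau>\<close>. But \<open>\<tau>\<close> is itself
  controlled by \<open>e\<close>. As \<open>I\<close> and \<open>S\<close> have the same size, there are \<open>d\<close> wrongly kept indices,
  where \<open>e\<close> equals \<open>z\<close> and is at least \<open>\<tau>\<close> in magnitude; and if \<open>d = 0\<close>, then \<open>p\<close> lies outside
  \<open>S\<close>, so that \<open>e\<close> has magnitude exactly \<open>\<tau>\<close> at \<open>p\<close>.

  Composing the two estimates bounds the new error by \<open>\<rho>\<close> times the old one plus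
  \<open>s L\<close> times the norm of \<open>A\<^sup>T \<epsilon>\<close>; this affine recursion sums to a geometric series.
\<close>

section \<open>Restricting vectors to coordinate sets\<close>

definition restrict_vec :: "'n set \<Rightarrow> real ^ 'n \<Rightarrow> real ^ 'n" where
  "restrict_vec W v = (\<chi> i. if i \<in> W then v $ i else 0)"

lemma norm_restrict_vec_squared: "(norm (restrict_vec W v))\<^sup>2 = (\<Sum>i\<in>W. (v $ i)\<^sup>2)"
proof -
  have "(norm (restrict_vec W v))\<^sup>2 = (\<Sum>i\<in>UNIV. if i \<in> W then (v $ i)\<^sup>2 else 0)"
    unfolding power2_norm_eq_inner inner_vec_def restrict_vec_def
    by (intro sum.cong) (auto simp: power2_eq_square)
  also have "\<dots> = (\<Sum>i\<in>W. (v $ i)\<^sup>2)"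
    by (simp add: sum.If_cases)
  finally show ?thesis .
qed

lemma restrict_vec_add: "restrict_vec W (u + v) = restrict_vec W u + restrict_vec W v"
  by (simp add: restrict_vec_def vec_eq_iff)

lemma norm_restrict_vec_le: "norm (restrict_vec W v) \<le> norm v"
proof -
  have "(norm v)\<^sup>2 = (\<Sum>i\<in>UNIV. (v $ i)\<^sup>2)"
    unfolding power2_norm_eq_inner inner_vec_def by (simp add: power2_eq_square)
  then have "(norm (restrict_vec W v))\<^sup>2 \<le> (norm v)\<^sup>2"
    unfolding norm_restrict_vec_squared by (simp add: sum_mono2)
  then show ?thesis
    by (rule power2_le_imp_le) simp
qed

lemma restrict_vec_eq_self: "(\<And>i. i \<notin> W \<Longrightarrow> v $ i = 0) \<Longrightarrow> restrict_vec W v = v"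
  by (auto simp: restrict_vec_def vec_eq_iff)

lemma restrict_vec_inner_self:
  "restrict_vec W v \<bullet> v = (norm (restrict_vec W v))\<^sup>2"
  unfolding power2_norm_eq_inner inner_vec_def restrict_vec_def
  by (intro sum.cong) auto

section \<open>The restricted isometry constant\<close>

text \<open>
  The least constant is a genuine minimum: the admissible constants form a closed set, which is
  nonempty because \<open>A\<close> is bounded, and bounded below because a coordinate vector is sparse.
  For \<open>r = 0\<close> every real number is admissible, so there is no least one.
\<close>

lemma restricted_isometry_const:
  fixes A :: "real ^ 'n ^ 'm"
  assumes "1 \<le> r"
  shows restricted_isometry_const_nonneg: "0 \<le> restricted_isometry_const A r"
    and restricted_isometry_const_bounds: "l0norm z \<le> r \<Longrightarrow>
      (1 - restricted_isometry_const A r) * (norm z)\<^sup>2 \<le> (norm (A *v z))\<^sup>2 \<and>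
      (norm (A *v z))\<^sup>2 \<le> (1 + restricted_isometry_const A r) * (norm z)\<^sup>2"
proof -
  define P where "P \<delta> \<longleftrightarrow> (\<forall>z. l0norm z \<le> r \<longrightarrow>
        (1 - \<delta>) * (norm z)\<^sup>2 \<le> (norm (A *v z))\<^sup>2 \<and>
        (norm (A *v z))\<^sup>2 \<le> (1 + \<delta>) * (norm z)\<^sup>2)" for \<delta>
  have closed: "closed {\<delta>. P \<delta>}"
    unfolding P_def
    by (intro closed_Collect_all closed_Collect_imp open_Collect_const closed_Collect_conj
        closed_Collect_le continuous_intros)
  have nonneg: "0 \<le> \<delta>" if "P \<delta>" for \<delta>
  proof -
    fix j :: 'n
    have "{i. axis j (1::real) $ i \<noteq> 0} = {j}"
      by (auto simp: axis_def)
    then have "l0norm (axis j (1::real)) \<le> r"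
      using assms by (simp add: l0norm_def)
    then have "(1 - \<delta>) * (norm (axis j (1::real)))\<^sup>2 \<le> (1 + \<delta>) * (norm (axis j (1::real)))\<^sup>2"
      using that unfolding P_def by (meson order_trans)
    then show ?thesis
      by simp
  qed
  obtain K where K: "norm (A *v z) \<le> norm z * K" for z
    using bounded_linear.bounded[OF matrix_vector_mul_bounded_linear[of A]] by blast
  have "P (1 + K\<^sup>2)"
    unfolding P_def
  proof (intro allI impI conjI)
    fix z :: "real ^ 'n"
    have "(1 - (1 + K\<^sup>2)) * (norm z)\<^sup>2 \<le> 0"
      by (simp add: mult_nonpos_nonneg)
    then show "(1 - (1 + K\<^sup>2)) * (norm z)\<^sup>2 \<le> (norm (A *v z))\<^sup>2"
      by (rule order_trans) simp
    have "(norm (A *v z))\<^sup>2 \<le> (norm z * K)\<^sup>2"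
      by (intro power_mono K) simp
    also have "\<dots> \<le> (1 + (1 + K\<^sup>2)) * (norm z)\<^sup>2"
      by (simp add: power_mult_distrib algebra_simps)
    finally show "(norm (A *v z))\<^sup>2 \<le> (1 + (1 + K\<^sup>2)) * (norm z)\<^sup>2" .
  qed
  then have "{\<delta>. P \<delta>} \<noteq> {}"
    by blast
  moreover have bdd: "bdd_below {\<delta>. P \<delta>}"
    using nonneg by (intro bdd_belowI[of _ 0]) auto
  ultimately have P_Inf: "P (Inf {\<delta>. P \<delta>})"
    using closed_contains_Inf[of "{\<delta>. P \<delta>}"] closed by simp
  then have "(LEAST \<delta>. P \<delta>) = Inf {\<delta>. P \<delta>}"
    by (rule Least_equality) (auto intro: cInf_lower bdd)
  then have P_ric: "P (restricted_isometry_const A r)"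
    using P_Inf unfolding restricted_isometry_const_def P_def by simp
  then show "0 \<le> restricted_isometry_const A r"
    by (rule nonneg)
  show "l0norm z \<le> r \<Longrightarrow>
      (1 - restricted_isometry_const A r) * (norm z)\<^sup>2 \<le> (norm (A *v z))\<^sup>2 \<and>
      (norm (A *v z))\<^sup>2 \<le> (1 + restricted_isometry_const A r) * (norm z)\<^sup>2"
    using P_ric unfolding P_def by simp
qed

section \<open>The gradient step\<close>

lemma l0norm_le_card: "(\<And>i. i \<notin> T \<Longrightarrow> z $ i = 0) \<Longrightarrow> l0norm z \<le> card T"
  unfolding l0norm_def by (intro card_mono) auto

lemma restricted_isometry_quadratic:
  fixes A :: "real ^ 'n ^ 'm"
  assumes "1 \<le> r" "0 \<le> s" "l0norm z \<le> r"
  shows "\<bar>(norm z)\<^sup>2 - s * (norm (A *v z))\<^sup>2\<bar>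
    \<le> (\<bar>1 - s\<bar> + s * restricted_isometry_const A r) * (norm z)\<^sup>2"
proof -
  let ?\<delta> = "restricted_isometry_const A r" and ?N = "(norm z)\<^sup>2"
  let ?D = "?N - (norm (A *v z))\<^sup>2"
  have "\<bar>?D\<bar> \<le> ?\<delta> * ?N"
    using restricted_isometry_const_bounds[OF assms(1,3), of A] by (auto simp: abs_le_iff algebra_simps)
  then have "\<bar>s * ?D\<bar> \<le> s * (?\<delta> * ?N)"
    using assms(2) by (simp add: abs_mult mult_left_mono)
  moreover have "?N - s * (norm (A *v z))\<^sup>2 = (1 - s) * ?N + s * ?D"
    by (simp add: algebra_simps)
  moreover have "\<bar>(1 - s) * ?N\<bar> = \<bar>1 - s\<bar> * ?N"
    by (simp add: abs_mult)
  ultimately show ?thesis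
    by (simp add: algebra_simps)
qed

text \<open>
  Polarisation turns the bound on the quadratic form into one on the bilinear form. It applies
  because sums and differences of vectors supported in \<open>T\<close> stay supported in \<open>T\<close>; normalising
  the two vectors first makes the parallelogram law give their product of norms.
\<close>

lemma restricted_isometry_bilinear:
  fixes A :: "real ^ 'n ^ 'm"
  assumes r: "1 \<le> r" "card T \<le> r" and s: "0 \<le> s"
    and u: "\<And>i. i \<notin> T \<Longrightarrow> u $ i = 0" and v: "\<And>i. i \<notin> T \<Longrightarrow> v $ i = 0"
  shows "\<bar>u \<bullet> v - s * ((A *v u) \<bullet> (A *v v))\<bar>
    \<le> (\<bar>1 - s\<bar> + s * restricted_isometry_const A r) * (norm u * norm v)"
proof -
  let ?\<gamma> = "\<bar>1 - s\<bar> + s * restricted_isometry_const A r"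
  let ?B = "\<lambda>u v. u \<bullet> v - s * ((A *v u) \<bullet> (A *v v))"
  have quadratic: "\<bar>?B w w\<bar> \<le> ?\<gamma> * (w \<bullet> w)" if "\<And>i. i \<notin> T \<Longrightarrow> w $ i = 0" for w
    using restricted_isometry_quadratic[OF r(1) s, of w A] l0norm_le_card[of T w, OF that] r(2)
    by (simp add: power2_norm_eq_inner)
  have unit: "\<bar>?B u v\<bar> \<le> ?\<gamma>"
    if "norm u = 1" "norm v = 1" "\<And>i. i \<notin> T \<Longrightarrow> u $ i = 0" "\<And>i. i \<notin> T \<Longrightarrow> v $ i = 0" for u v
  proof -
    have norms: "u \<bullet> u = 1" "v \<bullet> v = 1"
      using that(1,2) by (simp_all add: norm_eq_1)
    have "4 * ?B u v = ?B (u + v) (u + v) - ?B (u - v) (u - v)"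
      by (simp add: matrix_vector_right_distrib matrix_vector_mult_diff_distrib
          inner_add_left inner_add_right inner_diff_left inner_diff_right inner_commute algebra_simps)
    moreover have "\<bar>?B (u + v) (u + v)\<bar> \<le> ?\<gamma> * ((u + v) \<bullet> (u + v))"
      and "\<bar>?B (u - v) (u - v)\<bar> \<le> ?\<gamma> * ((u - v) \<bullet> (u - v))"
      using that(3,4) by (intro quadratic; simp)+
    moreover have "?\<gamma> * ((u + v) \<bullet> (u + v)) + ?\<gamma> * ((u - v) \<bullet> (u - v)) = ?\<gamma> * 4"
      unfolding distrib_left[symmetric]
      by (simp add: norms inner_add_left inner_add_right inner_diff_left inner_diff_right)
    moreover have "\<bar>p\<bar> \<le> g"
      if "4 * p = q - q'" "\<bar>q\<bar> \<le> c" "\<bar>q'\<bar> \<le> c'" "c + c' = g * 4" for p q q' c c' g :: real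
      using that by linarith
    ultimately show ?thesis
      by blast
  qed
  show ?thesis
  proof (cases "u = 0 \<or> v = 0")
    case False
    then have "\<bar>?B (u /\<^sub>R norm u) (v /\<^sub>R norm v)\<bar> \<le> ?\<gamma>"
      using u v by (intro unit) auto
    moreover have "?B (u /\<^sub>R norm u) (v /\<^sub>R norm v) = ?B u v / (norm u * norm v)"
      by (simp add: matrix_vector_mult_scaleR divide_simps)
    ultimately have "\<bar>?B u v / (norm u * norm v)\<bar> \<le> ?\<gamma>"
      by (simp only:)
    then show ?thesis
      using False by (simp add: abs_mult pos_divide_le_eq)
  qed auto
qed

text \<open>
  The bilinear bound is tested against the restricted vector itself, which is
  why \<open>W\<close> may differ from the support of \<open>h\<close> as long as both fit into \<open>T\<close>.
\<close>

lemma gradient_step_contraction: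
  fixes A :: "real ^ 'n ^ 'm"
  assumes "1 \<le> r" "card T \<le> r" "0 \<le> s" "W \<subseteq> T"
    and h: "\<And>i. i \<notin> T \<Longrightarrow> h $ i = 0"
  shows "norm (restrict_vec W (h - s *\<^sub>R (transpose A *v (A *v h))))
    \<le> (\<bar>1 - s\<bar> + s * restricted_isometry_const A r) * norm h"
proof -
  let ?\<gamma> = "\<bar>1 - s\<bar> + s * restricted_isometry_const A r"
  define v where "v = h - s *\<^sub>R (transpose A *v (A *v h))"
  define w where "w = restrict_vec W v"
  have "w $ i = 0" if "i \<notin> T" for i
    using that assms(4) by (auto simp: w_def restrict_vec_def)
  then have "\<bar>w \<bullet> h - s * ((A *v w) \<bullet> (A *v h))\<bar> \<le> ?\<gamma> * (norm w * norm h)"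
    using assms by (intro restricted_isometry_bilinear)
  moreover have "w \<bullet> (transpose A *v (A *v h)) = (A *v w) \<bullet> (A *v h)"
    by (metis dot_lmul_matrix inner_commute transpose_matrix_vector)
  then have "w \<bullet> v = w \<bullet> h - s * ((A *v w) \<bullet> (A *v h))"
    by (simp add: v_def inner_diff_right)
  moreover have "w \<bullet> v = (norm w)\<^sup>2"
    unfolding w_def by (rule restrict_vec_inner_self)
  ultimately have le: "norm w * norm w \<le> norm w * (?\<gamma> * norm h)"
    by (simp add: power2_eq_square mult_ac)
  have "0 \<le> ?\<gamma> * norm h"
    using assms(3) restricted_isometry_const_nonneg[OF assms(1), of A] by simp
  with le have "norm w \<le> ?\<gamma> * norm h"
    by (cases "w = 0") auto
  then show ?thesis
    by (simp add: w_def v_def)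
qed

section \<open>The thresholding step\<close>

lemma defining_function_bounds:
  assumes "defining_function f c1 c2" "0 \<le> \<tau>" "\<tau> \<le> \<bar>u\<bar>"
  shows "\<bar>f \<tau> u - u\<bar> \<le> c1 * \<tau>" and "\<bar>f \<tau> u\<bar> \<le> \<bar>u\<bar>"
proof -
  have c: "0 \<le> c2" "c2 \<le> c1" "c1 \<le> 1"
    and odd: "f \<tau> (- u) = - f \<tau> u"
    and bounds: "\<And>u. \<tau> \<le> u \<Longrightarrow> u - c1 * \<tau> \<le> f \<tau> u \<and> f \<tau> u \<le> u - c2 * \<tau>"
    using assms unfolding defining_function_def by auto
  have prods: "0 \<le> c2 * \<tau>" "c2 * \<tau> \<le> c1 * \<tau>" "c1 * \<tau> \<le> \<tau>"
    using c assms(2) by (simp_all add: mult_right_mono mult_left_le_one_le)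
  have "\<bar>f \<tau> u - u\<bar> \<le> c1 * \<tau> \<and> \<bar>f \<tau> u\<bar> \<le> \<bar>u\<bar>"
  proof (cases "0 \<le> u")
    case True
    then show ?thesis
      using bounds[of u] prods assms(3) by auto
  next
    case False
    then show ?thesis
      using bounds[of "- u"] odd prods assms(3) by auto
  qed
  then show "\<bar>f \<tau> u - u\<bar> \<le> c1 * \<tau>" and "\<bar>f \<tau> u\<bar> \<le> \<bar>u\<bar>"
    by auto
qed

lemma square_le_two_squares:
  fixes a b y :: real
  assumes "\<bar>y\<bar> \<le> \<bar>a\<bar> + b"
  shows "y\<^sup>2 \<le> 2 * a\<^sup>2 + 2 * b\<^sup>2"
proof -
  have "y\<^sup>2 \<le> (\<bar>a\<bar> + b)\<^sup>2"
    using assms by (metis abs_ge_zero power2_abs power_mono)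
  also have "\<dots> \<le> 2 * a\<^sup>2 + 2 * b\<^sup>2"
    using zero_le_power2[of "\<bar>a\<bar> - b"] by (simp add: power2_eq_square algebra_simps)
  finally show ?thesis .
qed

text \<open>
  The threshold is detected by the error outside the support \<open>S\<close>: with multiplicity at every
  wrongly kept index, and at \<open>p\<close> if there is none. The second alternative needs \<open>I\<close> and \<open>S\<close> to
  have the same size, as otherwise \<open>I\<close> could be a proper subset of \<open>S\<close> and \<open>p\<close> could lie in \<open>S\<close>.
\<close>

lemma threshold_le_error:
  fixes z y :: "real ^ 'n"
  defines "S \<equiv> {i. y $ i \<noteq> 0}"
  assumes I: "largest_index_set k z I" and p: "next_largest_index z I p" and y: "l0norm y = k"
  shows "real (card (I - S)) * \<bar>z $ p\<bar>\<^sup>2 \<le> (\<Sum>i\<in>(I \<union> {p}) - S. ((z - y) $ i)\<^sup>2)"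
    and "\<bar>z $ p\<bar>\<^sup>2 \<le> (\<Sum>i\<in>(I \<union> {p}) - S. ((z - y) $ i)\<^sup>2)"
proof -
  let ?E = "\<Sum>i\<in>(I \<union> {p}) - S. ((z - y) $ i)\<^sup>2"
  have cards: "card I = k" "card S = k"
    using I y by (auto simp: largest_index_set_def l0norm_def S_def)
  have kept_large: "\<bar>z $ p\<bar>\<^sup>2 \<le> ((z - y) $ i)\<^sup>2" if "i \<in> (I \<union> {p}) - S" for i
  proof -
    have "\<bar>z $ p\<bar> \<le> \<bar>z $ i\<bar>"
      using that I p by (auto simp: largest_index_set_def next_largest_index_def)
    then show ?thesis
      using that by (simp add: S_def abs_le_square_iff)
  qed
  have many: "real (card J) * \<bar>z $ p\<bar>\<^sup>2 \<le> ?E" if "J \<subseteq> (I \<union> {p}) - S" for J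
  proof -
    have "real (card J) * \<bar>z $ p\<bar>\<^sup>2 = (\<Sum>i\<in>J. \<bar>z $ p\<bar>\<^sup>2)"
      by simp
    also have "\<dots> \<le> (\<Sum>i\<in>J. ((z - y) $ i)\<^sup>2)"
      using that kept_large by (intro sum_mono) blast
    also have "\<dots> \<le> ?E"
      using that by (intro sum_mono2) auto
    finally show ?thesis .
  qed
  then show "real (card (I - S)) * \<bar>z $ p\<bar>\<^sup>2 \<le> ?E"
    by blast
  have "(I \<union> {p}) - S \<noteq> {}"
  proof
    assume "(I \<union> {p}) - S = {}"
    moreover from this have "I = S"
      using cards by (intro card_subset_eq) auto
    ultimately show False
      using p by (auto simp: next_largest_index_def)
  qed
  then obtain j where "j \<in> (I \<union> {p}) - S"
    by blast
  then show "\<bar>z $ p\<bar>\<^sup>2 \<le> ?E"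
    using many[of "{j}"] by simp
qed

text \<open>
  Missed indices contribute \<open>2 e\<^sup>2 + 2 \<tau>\<^sup>2\<close>, correctly kept ones \<open>2 e\<^sup>2 + 2 c1\<^sup>2 \<tau>\<^sup>2\<close>, and wrongly kept
  ones only \<open>e\<^sup>2\<close>, because thresholding moves towards zero, which is the target there.
  The two constants bound the \<open>\<tau>\<close>-terms differently. In the first, all \<open>d\<close> copies of \<open>\<tau>\<^sup>2\<close> from missed
  indices are paid for by the \<open>d\<close> wrongly kept ones together; in the second, \<open>c1\<close> is replaced by
  \<open>1\<close> and each of the \<open>k\<close> copies is bounded by the whole error outside the support. The two
  constants are at most the radicands \<open>4 + 2 c1\<^sup>2 k\<close> and \<open>2 + (3 - c2\<^sup>2) k\<close> of \<open>L\<close>, respectively.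
\<close>

lemma thresholding_error:
  fixes z y :: "real ^ 'n"
  assumes f: "defining_function f c1 c2"
    and I: "largest_index_set k z I" and p: "next_largest_index z I p" and y: "l0norm y = k"
  shows "(norm ((\<chi> i. if i \<in> I then f \<bar>z $ p\<bar> (z $ i) else 0) - y))\<^sup>2
    \<le> min (3 + 2 * c1\<^sup>2 * real k) (2 + 2 * real k) *
      (norm (restrict_vec (I \<union> {i. y $ i \<noteq> 0} \<union> {p}) (z - y)))\<^sup>2"
proof -
  define S where "S = {i. y $ i \<noteq> 0}"
  define \<tau> where "\<tau> = \<bar>z $ p\<bar>"
  define x where "x = (\<chi> i. if i \<in> I then f \<tau> (z $ i) else 0)"
  define e where "e = z - y"
  define E where "E = (\<Sum>i\<in>(I \<union> {p}) - S. (e $ i)\<^sup>2)"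
  define G where "G = (\<Sum>i\<in>S. (e $ i)\<^sup>2)"
  define d where "d = card (S - I)"
  have cards: "card I = k" "card S = k"
    using I y by (auto simp: largest_index_set_def l0norm_def S_def)
  have d_eq: "card (I - S) = d"
    unfolding d_def using cards
    by (metis card_Diff_subset_Int finite finite_Int inf_commute)
  have d_le: "d \<le> k"
    unfolding d_def using cards by (metis Diff_subset card_mono finite)
  have card_both: "card (S \<inter> I) = k - d"
    using card_Diff_subset_Int[of S I] card_mono[of S "S \<inter> I"] cards
    unfolding d_def by auto
  have \<tau>: "real d * \<tau>\<^sup>2 \<le> E" "\<tau>\<^sup>2 \<le> E"
    using threshold_le_error[OF I p y] unfolding d_eq[symmetric] \<tau>_def E_def e_def S_def by auto
  have E_nonneg: "0 \<le> E" and G_nonneg: "0 \<le> G"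
    by (simp_all add: E_def G_def sum_nonneg)
  have c1: "0 \<le> c1" "c1 \<le> 1"
    using f by (auto simp: defining_function_def)
  have in_I: "\<tau> \<le> \<bar>z $ i\<bar>" if "i \<in> I" for i
    using that I p by (auto simp: largest_index_set_def next_largest_index_def \<tau>_def)
  have not_in_I: "\<bar>z $ i\<bar> \<le> \<tau>" if "i \<notin> I" for i
    using that p by (auto simp: next_largest_index_def \<tau>_def)
  have \<tau>_nonneg: "0 \<le> \<tau>"
    by (simp add: \<tau>_def)

  have missed: "((x - y) $ i)\<^sup>2 \<le> 2 * (e $ i)\<^sup>2 + 2 * \<tau>\<^sup>2" if "i \<in> S - I" for i
  proof (rule square_le_two_squares)
    show "\<bar>(x - y) $ i\<bar> \<le> \<bar>e $ i\<bar> + \<tau>"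
      using that not_in_I[of i] by (simp add: x_def e_def)
  qed
  have kept: "((x - y) $ i)\<^sup>2 \<le> 2 * (e $ i)\<^sup>2 + 2 * (c1 * \<tau>)\<^sup>2" if "i \<in> S \<inter> I" for i
  proof (rule square_le_two_squares)
    show "\<bar>(x - y) $ i\<bar> \<le> \<bar>e $ i\<bar> + c1 * \<tau>"
      using that defining_function_bounds(1)[OF f \<tau>_nonneg in_I[of i]] by (simp add: x_def e_def)
  qed
  have wrong: "((x - y) $ i)\<^sup>2 \<le> (e $ i)\<^sup>2" if "i \<in> I - S" for i
    using that defining_function_bounds(2)[OF f \<tau>_nonneg in_I[of i]]
    by (simp add: x_def e_def S_def abs_le_square_iff)

  have "restrict_vec (S \<union> I) (x - y) = x - y"
    by (rule restrict_vec_eq_self) (auto simp: x_def S_def)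
  then have "(norm (x - y))\<^sup>2 = (\<Sum>i\<in>S \<union> I. ((x - y) $ i)\<^sup>2)"
    by (metis norm_restrict_vec_squared)
  also have "S \<union> I = (S - I) \<union> (S \<inter> I) \<union> (I - S)"
    by blast
  also have "(\<Sum>i\<in>\<dots>. ((x - y) $ i)\<^sup>2) = (\<Sum>i\<in>S - I. ((x - y) $ i)\<^sup>2)
      + (\<Sum>i\<in>S \<inter> I. ((x - y) $ i)\<^sup>2) + (\<Sum>i\<in>I - S. ((x - y) $ i)\<^sup>2)"
    by (subst sum.union_disjoint; (subst sum.union_disjoint)?) auto
  also have "\<dots> \<le> (\<Sum>i\<in>S - I. 2 * (e $ i)\<^sup>2 + 2 * \<tau>\<^sup>2)
      + (\<Sum>i\<in>S \<inter> I. 2 * (e $ i)\<^sup>2 + 2 * (c1 * \<tau>)\<^sup>2) + (\<Sum>i\<in>I - S. (e $ i)\<^sup>2)"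
    by (intro add_mono sum_mono missed kept wrong)
  also have "\<dots> = 2 * ((\<Sum>i\<in>S - I. (e $ i)\<^sup>2) + (\<Sum>i\<in>S \<inter> I. (e $ i)\<^sup>2))
      + (\<Sum>i\<in>I - S. (e $ i)\<^sup>2) + 2 * real d * \<tau>\<^sup>2 + 2 * real (k - d) * (c1 * \<tau>)\<^sup>2"
    by (simp add: sum.distrib sum_distrib_left d_def[symmetric] card_both algebra_simps)
  also have "(\<Sum>i\<in>S - I. (e $ i)\<^sup>2) + (\<Sum>i\<in>S \<inter> I. (e $ i)\<^sup>2) = G"
    unfolding G_def by (subst sum.union_disjoint[symmetric]) (auto intro: sum.cong)
  also have "(\<Sum>i\<in>I - S. (e $ i)\<^sup>2) \<le> E"
    unfolding E_def by (intro sum_mono2) auto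
  finally have main: "(norm (x - y))\<^sup>2
      \<le> 2 * G + E + 2 * (real d * \<tau>\<^sup>2) + 2 * (real (k - d) * (c1\<^sup>2 * \<tau>\<^sup>2))"
    by (simp add: power_mult_distrib mult.assoc)

  have "real (k - d) * (c1\<^sup>2 * \<tau>\<^sup>2) \<le> real k * (c1\<^sup>2 * E)"
    using \<tau>(2) by (intro mult_mono) auto
  moreover have "0 \<le> real k * (c1\<^sup>2 * G)"
    using G_nonneg by simp
  moreover have "(3 + 2 * c1\<^sup>2 * real k) * (G + E)
      = 3 * G + 3 * E + 2 * (real k * (c1\<^sup>2 * G)) + 2 * (real k * (c1\<^sup>2 * E))"
    by (simp add: algebra_simps)
  ultimately have first: "(norm (x - y))\<^sup>2 \<le> (3 + 2 * c1\<^sup>2 * real k) * (G + E)"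
    using main \<tau>(1) G_nonneg by linarith

  have "real (k - d) * (c1\<^sup>2 * \<tau>\<^sup>2) \<le> real (k - d) * (1 * \<tau>\<^sup>2)"
    using c1 by (intro mult_left_mono mult_right_mono) (auto simp: power_le_one)
  then have "real d * \<tau>\<^sup>2 + real (k - d) * (c1\<^sup>2 * \<tau>\<^sup>2) \<le> real k * \<tau>\<^sup>2"
    using d_le by (simp add: of_nat_diff algebra_simps)
  also have "\<dots> \<le> real k * E"
    using \<tau>(2) by (intro mult_left_mono) auto
  finally have "2 * (real d * \<tau>\<^sup>2) + 2 * (real (k - d) * (c1\<^sup>2 * \<tau>\<^sup>2)) \<le> 2 * (real k * E)"
    by simp
  moreover have "0 \<le> real k * G"
    using G_nonneg by simp
  ultimately have second: "(norm (x - y))\<^sup>2 \<le> (2 + 2 * real k) * (G + E)"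
    using main E_nonneg by (simp add: algebra_simps)

  have "G + E = (\<Sum>i\<in>I \<union> S \<union> {p}. (e $ i)\<^sup>2)"
    unfolding G_def E_def by (subst sum.union_disjoint[symmetric]) (auto intro: sum.cong)
  with first second show ?thesis
    unfolding norm_restrict_vec_squared x_def e_def S_def \<tau>_def min_def by simp
qed

section \<open>Convergence of the iteration\<close>

lemma l0norm_ait_step:
  assumes "ait_step A b k s f x x'"
  shows "l0norm x' \<le> k"
proof -
  obtain I :: "'a set" and g where "card I = k" "x' = (\<chi> i. if i \<in> I then g i else 0)"
    using assms unfolding ait_step_def Let_def largest_index_set_def by auto
  then show ?thesis
    using l0norm_le_card[of I x'] by simp
qed

lemma ait_step_error:
  fixes A :: "real ^ 'n ^ 'm"
  assumes step: "ait_step A (A *v y + \<epsilon>) k s f x x'"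
    and y: "l0norm y = k" and x: "l0norm x \<le> k"
    and f: "defining_function f c1 c2" and s: "0 \<le> s"
    and L: "0 \<le> L" "min (3 + 2 * c1\<^sup>2 * real k) (2 + 2 * real k) \<le> L\<^sup>2"
  shows "norm (x' - y) \<le> L * ((\<bar>1 - s\<bar> + s * restricted_isometry_const A (3 * k + 1)) * norm (x - y)
      + s * norm (transpose A *v \<epsilon>))"
proof -
  define z where "z = x - s *\<^sub>R (transpose A *v (A *v x - (A *v y + \<epsilon>)))"
  obtain I p where I: "largest_index_set k z I" and p: "next_largest_index z I p"
    and x': "x' = (\<chi> i. if i \<in> I then f \<bar>z $ p\<bar> (z $ i) else 0)"
    using step unfolding ait_step_def Let_def z_def by blast
  define S where "S = {i. y $ i \<noteq> 0}"
  define W where "W = I \<union> S \<union> {p}"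
  define T where "T = W \<union> {i. x $ i \<noteq> 0}"
  let ?\<gamma> = "\<bar>1 - s\<bar> + s * restricted_isometry_const A (3 * k + 1)"
  let ?h = "x - y"
  have "card T \<le> card W + card {i. x $ i \<noteq> 0}" and "card W \<le> card (I \<union> S) + card {p}"
    and "card (I \<union> S) \<le> card I + card S"
    unfolding T_def W_def by (rule card_Un_le)+
  moreover have "card I = k" "card S = k" "card {i. x $ i \<noteq> 0} \<le> k"
    using I x y by (auto simp: largest_index_set_def l0norm_def S_def)
  ultimately have "card T \<le> 3 * k + 1"
    by simp
  then have contraction:
    "norm (restrict_vec W (?h - s *\<^sub>R (transpose A *v (A *v ?h)))) \<le> ?\<gamma> * norm ?h"
    using s by (intro gradient_step_contraction[of _ T]) (auto simp: T_def W_def S_def)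
  have "z - y = (?h - s *\<^sub>R (transpose A *v (A *v ?h))) + s *\<^sub>R (transpose A *v \<epsilon>)"
    by (simp add: z_def matrix_vector_mult_diff_distrib matrix_vector_right_distrib algebra_simps)
  then have "norm (restrict_vec W (z - y))
      \<le> norm (restrict_vec W (?h - s *\<^sub>R (transpose A *v (A *v ?h))))
        + norm (restrict_vec W (s *\<^sub>R (transpose A *v \<epsilon>)))"
    by (metis restrict_vec_add norm_triangle_ineq)
  also have "\<dots> \<le> ?\<gamma> * norm ?h + norm (s *\<^sub>R (transpose A *v \<epsilon>))"
    by (intro add_mono contraction norm_restrict_vec_le)
  finally have e: "norm (restrict_vec W (z - y)) \<le> ?\<gamma> * norm ?h + s * norm (transpose A *v \<epsilon>)"
    using s by simp
  have "(norm (x' - y))\<^sup>2 \<le> min (3 + 2 * c1\<^sup>2 * real k) (2 + 2 * real k)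
      * (norm (restrict_vec W (z - y)))\<^sup>2"
    using thresholding_error[OF f I p y] unfolding x' W_def S_def .
  also have "\<dots> \<le> L\<^sup>2 * (norm (restrict_vec W (z - y)))\<^sup>2"
    by (intro mult_right_mono L) simp
  finally have "(norm (x' - y))\<^sup>2 \<le> (L * norm (restrict_vec W (z - y)))\<^sup>2"
    by (simp add: power_mult_distrib)
  then have "norm (x' - y) \<le> L * norm (restrict_vec W (z - y))"
    by (rule power2_le_imp_le) (simp add: L)
  also have "\<dots> \<le> L * (?\<gamma> * norm ?h + s * norm (transpose A *v \<epsilon>))"
    by (intro mult_left_mono e L)
  finally show ?thesis .
qed

lemma affine_recursion_bound:
  fixes a :: "nat \<Rightarrow> real"
  assumes step: "\<And>t. a (Suc t) \<le> \<rho> * a t + c" and \<rho>: "0 \<le> \<rho>" "\<rho> < 1" and c: "0 \<le> c"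
  shows "a t \<le> \<rho> ^ t * a 0 + c / (1 - \<rho>)"
proof (induction t)
  case 0
  then show ?case
    using \<rho> c by simp
next
  case (Suc t)
  have "a (Suc t) \<le> \<rho> * (\<rho> ^ t * a 0 + c / (1 - \<rho>)) + c"
    using step[of t] mult_left_mono[OF Suc \<rho>(1)] by linarith
  also have "\<dots> = \<rho> ^ Suc t * a 0 + (\<rho> * (c / (1 - \<rho>)) + c)"
    by (simp add: algebra_simps)
  \<comment> \<open>\<open>c / (1 - \<rho>)\<close> is the fixed point of the affine map.\<close>
  also have "\<rho> * (c / (1 - \<rho>)) + c = c / (1 - \<rho>)"
    using \<rho> by (simp add: field_simps)
  finally show ?case .
qed

theorem corollary3:
  fixes A :: "real ^ 'n ^ 'm"
    and b \<epsilon> :: "real ^ 'm"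
    and xstar :: "real ^ 'n"
    and x :: "nat \<Rightarrow> real ^ 'n"
    and f :: "real \<Rightarrow> real \<Rightarrow> real"
    and k kstar :: nat
    and s c1 c2 L \<delta> \<gamma> \<rho> :: real
  assumes unit_columns: "\<And>j. norm (column j A) = 1"
    and xstar: "l0norm xstar = kstar"
    and b: "b = A *v xstar + \<epsilon>"
    and k_range: "1 \<le> k" "k < CARD('n)"
    and s_pos: "s > 0"
    and f: "defining_function f c1 c2"
    and x: "ait_sequence A b k s f x"
    and x0_sparse: "l0norm (x 0) \<le> k"
    and L: "L = min (sqrt (4 + 2 * c1\<^sup>2 * real kstar)) (sqrt (2 + (3 - c2\<^sup>2) * real kstar))"
    and \<delta>: "\<delta> = restricted_isometry_const A (3 * kstar + 1)"
    and \<gamma>: "\<gamma> = \<bar>1 - s\<bar> + s * \<delta>"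
    and \<rho>: "\<rho> = \<gamma> * L"
    and \<delta>_less: "\<delta> < 1 / L"
    and k_eq: "k = kstar"
    and s_range: "(1 - 1 / L) / (1 - \<delta>) < s" "s < (1 + 1 / L) / (1 + \<delta>)"
  shows "\<rho> < 1 \<and>
    (\<forall>t. norm (x t - xstar)
          \<le> \<rho> ^ t * norm (xstar - x 0) + s * L / (1 - \<rho>) * norm (transpose A *v \<epsilon>)) \<and>
    (\<epsilon> = 0 \<longrightarrow> (\<forall>t. norm (x t - xstar) \<le> \<rho> ^ t * norm (xstar - x 0)))"
proof -
  have c: "0 \<le> c1" "0 \<le> c2" "c2 \<le> 1"
    using f by (auto simp: defining_function_def)
  have k1: "1 \<le> real kstar"
    using k_range k_eq by simp
  have "c2\<^sup>2 \<le> 1"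
    using c by (simp add: power_le_one)
  then have second_large: "2 + 2 * real kstar \<le> 2 + (3 - c2\<^sup>2) * real kstar"
    by (simp add: mult_right_mono)
  have L_sq: "L\<^sup>2 = min (4 + 2 * c1\<^sup>2 * real kstar) (2 + (3 - c2\<^sup>2) * real kstar)"
    using second_large unfolding L min_def by auto
  \<comment> \<open>The bound \<open>2 \<le> L\<close> makes \<open>1 / L\<close> at most \<open>1 / 2\<close>, so that \<open>1 - \<delta>\<close> is positive.\<close>
  have "4 \<le> 2 + (3 - c2\<^sup>2) * real kstar"
    using second_large k1 by linarith
  then have "2\<^sup>2 \<le> L\<^sup>2"
    unfolding L_sq by simp
  moreover have L_nonneg: "0 \<le> L"
    using second_large unfolding L by simp
  ultimately have L2: "2 \<le> L"
    using power2_le_imp_le by blast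
  have \<delta>_nonneg: "0 \<le> \<delta>"
    unfolding \<delta> by (intro restricted_isometry_const_nonneg) simp
  have "1 / L \<le> 1 / 2"
    using L2 by (simp add: divide_simps)
  then have "\<delta> < 1"
    using \<delta>_less by simp
  then have "1 - 1 / L < s * (1 - \<delta>)" "s * (1 + \<delta>) < 1 + 1 / L"
    using s_range \<delta>_nonneg by (simp_all add: pos_divide_less_eq pos_less_divide_eq)
  then have "\<gamma> < 1 / L"
    unfolding \<gamma> by (auto simp: algebra_simps abs_if)
  then have \<rho>_less: "\<rho> < 1"
    unfolding \<rho> using L2 by (simp add: field_simps)
  have \<rho>_nonneg: "0 \<le> \<rho>"
    unfolding \<rho> \<gamma> using s_pos \<delta>_nonneg L_nonneg by simp

  have sparse: "l0norm (x t) \<le> k" for t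
    using x0_sparse x l0norm_ait_step unfolding ait_sequence_def by (cases t) blast+
  have step: "norm (x (Suc t) - xstar)
      \<le> \<rho> * norm (x t - xstar) + s * L * norm (transpose A *v \<epsilon>)" for t
  proof -
    have "ait_step A (A *v xstar + \<epsilon>) k s f (x t) (x (Suc t))"
      using x b by (simp add: ait_sequence_def)
    moreover have "l0norm xstar = k"
      using xstar k_eq by simp
    moreover have "min (3 + 2 * c1\<^sup>2 * real k) (2 + 2 * real k) \<le> L\<^sup>2"
      using second_large unfolding L_sq k_eq by auto
    ultimately have "norm (x (Suc t) - xstar)
        \<le> L * (\<gamma> * norm (x t - xstar) + s * norm (transpose A *v \<epsilon>))"
      using s_pos unfolding \<gamma> \<delta> k_eq[symmetric]
      by (intro ait_step_error[OF _ _ sparse f] L_nonneg) simp_all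
    then show ?thesis
      by (simp add: \<rho> algebra_simps)
  qed
  have bound: "norm (x t - xstar)
      \<le> \<rho> ^ t * norm (xstar - x 0) + s * L / (1 - \<rho>) * norm (transpose A *v \<epsilon>)" for t
    using affine_recursion_bound[of "\<lambda>t. norm (x t - xstar)", OF step \<rho>_nonneg \<rho>_less] s_pos L_nonneg
    by (simp add: norm_minus_commute)
  show ?thesis
    using \<rho>_less bound by force
qed

end
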